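(* Let $A$ be a chromotopology and $v$ a vertex of $A$. There exists a poset $P_v(A)$ such that: (1) the set of elements of $P_v(A)$ is $R(A)$; (2) $P_v(A)$ is a ranked poset which is rank-symmetric (if its height is $m$, the number of elements of rank $i$ equals the number of elements of rank $m-i$ for every $i$), with exactly one element of top rank and exactly one element of bottom rank; (3) whenever $C$ covers $B$ in $P_v(A)$, the ranking $C$ is obtained from $B$ by a vertex flip (vertex raising or vertex lowering) at a single vertex $w\neq v$.
   Context: A chromotopology of dimension $n$ is a finite connected simple bipartite graph in which every vertex has degree $n$, whose edges are colored by $[n]$ so that each vertex is incident to exactly one edge of each color, and such that for any distinct colors $i,j$ the edges of colors $i,j$ form a disjoint union of $4$-cycles. A ranking of $A$ is a function $h\colon V(A)\to\mathbf{Z}$ with $|h(u)-h(w)|=1$ for every edge $\{u,w\}$, considered up to adding a constant (equivalently, a ranked-poset structure having $A$ as Hasse diagram); $R(A)$ is the set of rankings. A vertex $w$ is a source (resp. sink) if all its neighbors have larger (resp. smaller) $h$-value. Vertex raising at a source $w$ replaces $h$ by $h+2\cdot\mathbf{1}_w$; vertex lowering at a sink $w$ replaces $h$ by $h-2\cdot\mathbf{1}_w$; both are called vertex flips. *)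

theory Defs
  imports Main "HOL-Library.FuncSet"
begin

section \<open>Finite simple graphs\<close>

text \<open>Undirected graphs are given by a vertex set and a set of two-element vertex sets.\<close>

definition finite_simple_graph :: "'a set \<Rightarrow> 'a set set \<Rightarrow> bool" where
  "finite_simple_graph V E \<longleftrightarrow> finite V \<and> (\<forall>e\<in>E. e \<subseteq> V \<and> card e = 2)"

definition connected_graph :: "'a set \<Rightarrow> 'a set set \<Rightarrow> bool" where
  "connected_graph V E \<longleftrightarrow>
     V \<noteq> {} \<and> (\<forall>u\<in>V. \<forall>w\<in>V. (u, w) \<in> {(x, y). {x, y} \<in> E}\<^sup>*)"

definition bipartite_graph :: "'a set \<Rightarrow> 'a set set \<Rightarrow> bool" where
  "bipartite_graph V E \<longleftrightarrow>
     (\<exists>X Y. X \<union> Y = V \<and> X \<inter> Y = {} \<and> (\<forall>e\<in>E. \<exists>x\<in>X. \<exists>y\<in>Y. e = {x, y}))"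

definition is_four_cycle :: "'a set set \<Rightarrow> bool" where
  "is_four_cycle S \<longleftrightarrow>
     (\<exists>a b c d. distinct [a, b, c, d] \<and> S = {{a, b}, {b, c}, {c, d}, {d, a}})"

text \<open>Disjointness of the cycles is disjointness of their vertex sets.\<close>

definition disjoint_union_of_four_cycles :: "'a set set \<Rightarrow> bool" where
  "disjoint_union_of_four_cycles S \<longleftrightarrow>
     (\<exists>\<C>. (\<forall>C\<in>\<C>. is_four_cycle C)
        \<and> (\<forall>C\<in>\<C>. \<forall>D\<in>\<C>. C \<noteq> D \<longrightarrow> \<Union>C \<inter> \<Union>D = {})
        \<and> \<Union>\<C> = S)"


section \<open>Chromotopologies and their rankings\<close>

locale chromotopology =
  fixes n :: nat and V :: "'a set" and E :: "'a set set" and col :: "'a set \<Rightarrow> nat"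
  assumes simple: "finite_simple_graph V E"
    and connected: "connected_graph V E"
    and bipartite: "bipartite_graph V E"
    and regular: "\<And>u. u \<in> V \<Longrightarrow> card {e \<in> E. u \<in> e} = n"
    and colors: "col \<in> E \<rightarrow> {1..n}"
    and color_at_vertex: "\<And>u i. u \<in> V \<Longrightarrow> i \<in> {1..n} \<Longrightarrow> \<exists>!e. e \<in> E \<and> u \<in> e \<and> col e = i"
    and two_colored: "\<And>i j. i \<in> {1..n} \<Longrightarrow> j \<in> {1..n} \<Longrightarrow> i \<noteq> j \<Longrightarrow>
      disjoint_union_of_four_cycles {e \<in> E. col e = i \<or> col e = j}"

text \<open>
  Functions on \<open>V\<close> are extensional (\<^const>\<open>undefined\<close> off \<open>V\<close>).
\<close>

definition ranking_functions :: "'a set \<Rightarrow> 'a set set \<Rightarrow> ('a \<Rightarrow> int) set" where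
  "ranking_functions V E =
     {h \<in> V \<rightarrow>\<^sub>E UNIV. \<forall>u w. {u, w} \<in> E \<longrightarrow> \<bar>h u - h w\<bar> = 1}"

definition shift_equiv :: "'a set \<Rightarrow> 'a set set \<Rightarrow> (('a \<Rightarrow> int) \<times> ('a \<Rightarrow> int)) set" where
  "shift_equiv V E =
     {(g, h). g \<in> ranking_functions V E \<and> h \<in> ranking_functions V E
        \<and> (\<exists>c. \<forall>u\<in>V. h u = g u + c)}"

definition rankings :: "'a set \<Rightarrow> 'a set set \<Rightarrow> ('a \<Rightarrow> int) set set" where
  "rankings V E = ranking_functions V E // shift_equiv V E"

definition is_source :: "'a set \<Rightarrow> 'a set set \<Rightarrow> ('a \<Rightarrow> int) \<Rightarrow> 'a \<Rightarrow> bool" where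
  "is_source V E h w \<longleftrightarrow> w \<in> V \<and> (\<forall>u. {u, w} \<in> E \<longrightarrow> h w < h u)"

definition is_sink :: "'a set \<Rightarrow> 'a set set \<Rightarrow> ('a \<Rightarrow> int) \<Rightarrow> 'a \<Rightarrow> bool" where
  "is_sink V E h w \<longleftrightarrow> w \<in> V \<and> (\<forall>u. {u, w} \<in> E \<longrightarrow> h u < h w)"

definition vertex_raise :: "'a \<Rightarrow> ('a \<Rightarrow> int) \<Rightarrow> ('a \<Rightarrow> int)" where
  "vertex_raise w h = h(w := h w + 2)"

definition vertex_lower :: "'a \<Rightarrow> ('a \<Rightarrow> int) \<Rightarrow> ('a \<Rightarrow> int)" where
  "vertex_lower w h = h(w := h w - 2)"

text \<open>
  Flips act on classes in \<^const>\<open>rankings\<close> through representatives; being a source or a sink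
  does not depend on the representative.
\<close>

definition raising_at ::
  "'a set \<Rightarrow> 'a set set \<Rightarrow> 'a \<Rightarrow> ('a \<Rightarrow> int) set \<Rightarrow> ('a \<Rightarrow> int) set \<Rightarrow> bool" where
  "raising_at V E w B C \<longleftrightarrow> (\<exists>h\<in>B. is_source V E h w \<and> vertex_raise w h \<in> C)"

definition lowering_at ::
  "'a set \<Rightarrow> 'a set set \<Rightarrow> 'a \<Rightarrow> ('a \<Rightarrow> int) set \<Rightarrow> ('a \<Rightarrow> int) set \<Rightarrow> bool" where
  "lowering_at V E w B C \<longleftrightarrow> (\<exists>h\<in>B. is_sink V E h w \<and> vertex_lower w h \<in> C)"

definition flip_at ::
  "'a set \<Rightarrow> 'a set set \<Rightarrow> 'a \<Rightarrow> ('a \<Rightarrow> int) set \<Rightarrow> ('a \<Rightarrow> int) set \<Rightarrow> bool" where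
  "flip_at V E w B C \<longleftrightarrow> raising_at V E w B C \<or> lowering_at V E w B C"


section \<open>Ranked posets\<close>

text \<open>
  A poset is a relation \<open>P\<close> with \<open>Partial_order P\<close>; its set of elements is \<^term>\<open>Field P\<close>, and
  \<open>(x, y) \<in> P\<close> means that \<open>x\<close> is below \<open>y\<close>.
\<close>

definition covers :: "'b rel \<Rightarrow> 'b \<Rightarrow> 'b \<Rightarrow> bool" where
  "covers P y x \<longleftrightarrow> (x, y) \<in> P \<and> x \<noteq> y \<and>
     \<not> (\<exists>z. (x, z) \<in> P \<and> (z, y) \<in> P \<and> z \<noteq> x \<and> z \<noteq> y)"

definition is_rank_function :: "'b rel \<Rightarrow> ('b \<Rightarrow> int) \<Rightarrow> bool" where
  "is_rank_function P \<rho> \<longleftrightarrow>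
     (\<forall>x y. covers P y x \<longrightarrow> \<rho> y = \<rho> x + 1)
     \<and> 0 \<in> \<rho> ` Field P \<and> (\<forall>x\<in>Field P. 0 \<le> \<rho> x)"

text \<open>
  Rank functions are normalised to have least value 0. Uniqueness is part of the definition, so
  that the rank of an element is determined by the order. Without it, an antichain would carry
  arbitrary rank functions.
\<close>

definition ranked_poset :: "'b rel \<Rightarrow> ('b \<Rightarrow> int) \<Rightarrow> bool" where
  "ranked_poset P \<rho> \<longleftrightarrow> Partial_order P \<and> is_rank_function P \<rho>
     \<and> (\<forall>\<sigma>. is_rank_function P \<sigma> \<longrightarrow> (\<forall>x\<in>Field P. \<sigma> x = \<rho> x))"

definition has_height :: "'b rel \<Rightarrow> ('b \<Rightarrow> int) \<Rightarrow> int \<Rightarrow> bool" where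
  "has_height P \<rho> m \<longleftrightarrow> m \<in> \<rho> ` Field P \<and> (\<forall>x\<in>Field P. \<rho> x \<le> m)"

definition rank_level :: "'b rel \<Rightarrow> ('b \<Rightarrow> int) \<Rightarrow> int \<Rightarrow> 'b set" where
  "rank_level P \<rho> i = {x \<in> Field P. \<rho> x = i}"

end

(*
  Every ranking class has a unique representative vanishing at v.  These normalised rankings,
  ordered pointwise, form the poset.  All normalised rankings have the same parity at each vertex
  (that of the distance d to v), and they lie between -d and d, both of which are rankings.
  If g < h, then a vertex w of smallest g-value among those with g w < h w is a source of g, is
  different from v, and raising it stays below h; so covers are vertex raisings and half the sum
  of the values is a rank function.  Negation reverses the order, whence rank symmetry.
*)
theory Submission
  imports Defs
begin

section \<open>Distance from the basepoint of a connected bipartite graph\<close>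

locale pointed_bipartite_graph =
  fixes V :: "'a set" and E :: "'a set set" and v :: 'a
  assumes simple: "finite_simple_graph V E"
    and connected: "connected_graph V E"
    and bipartite: "bipartite_graph V E"
    and basepoint: "v \<in> V"
begin

lemma finite_V: "finite V"
  using simple by (simp add: finite_simple_graph_def)

lemma edge_verts: "{u, w} \<in> E \<Longrightarrow> u \<in> V \<and> w \<in> V \<and> u \<noteq> w"
  using simple unfolding finite_simple_graph_def by fastforce

definition adj :: "'a rel" where
  "adj = {(x, y). {x, y} \<in> E}"

text \<open>For \<open>u\<close> in \<open>V\<close> connectedness supplies a walk from
  \<open>v\<close>. Off \<open>V\<close> there is none, since edges lie inside \<open>V\<close>, and
  \<open>LEAST\<close> is then unspecified.\<close>

definition dist :: "'a \<Rightarrow> nat" where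
  "dist u = (LEAST k. (v, u) \<in> adj ^^ k)"

lemma dist_walk:
  assumes "u \<in> V" shows "(v, u) \<in> adj ^^ dist u"
proof -
  have "(v, u) \<in> adj\<^sup>*"
    using connected assms basepoint unfolding connected_graph_def adj_def by blast
  then obtain k where "(v, u) \<in> adj ^^ k" by (auto simp: rtrancl_power)
  then show ?thesis unfolding dist_def by (rule LeastI)
qed

lemma dist_le: "(v, u) \<in> adj ^^ k \<Longrightarrow> dist u \<le> k"
  unfolding dist_def by (rule Least_le)

lemma dist_basepoint: "dist v = 0"
  using dist_le[of v 0] by simp

lemma dist_edge_le:
  assumes "{u, w} \<in> E" shows "dist w \<le> Suc (dist u)"
proof -
  have "(v, u) \<in> adj ^^ dist u" using assms edge_verts dist_walk by blast
  then have "(v, w) \<in> adj ^^ Suc (dist u)" using assms by (auto simp: adj_def)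
  then show ?thesis by (rule dist_le)
qed

text \<open>Prolonging a shortest walk by the edge bounds the difference by 1. The difference 0 is
  excluded by bipartiteness: the parity of a walk from \<open>v\<close> is determined by the side on
  which it ends.\<close>

lemma dist_edge:
  assumes e: "{u, w} \<in> E" shows "\<bar>int (dist u) - int (dist w)\<bar> = 1"
proof -
  obtain X Y where XY: "X \<inter> Y = {}" "\<forall>e\<in>E. \<exists>x\<in>X. \<exists>y\<in>Y. e = {x, y}"
    using bipartite unfolding bipartite_graph_def by blast
  have flip: "(x \<in> X) \<noteq> (y \<in> X)" if xy: "{x, y} \<in> E" for x y
  proof -
    obtain a b where "a \<in> X" "b \<in> Y" "{x, y} = {a, b}" using XY(2) xy by blast
    then show ?thesis using XY(1) by (auto simp: doubleton_eq_iff)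
  qed
  have walk: "((v \<in> X) = (x \<in> X)) = even k" if "(v, x) \<in> adj ^^ k" for x k
    using that
  proof (induction k arbitrary: x)
    case (Suc k)
    then obtain y where "(v, y) \<in> adj ^^ k" "{y, x} \<in> E" by (auto simp: adj_def)
    then show ?case using Suc.IH[of y] flip[of y x] by auto
  qed simp
  have "u \<in> V" "w \<in> V" using e edge_verts by auto
  then have "even (dist u) \<noteq> even (dist w)"
    using walk[OF dist_walk] flip[OF e] by metis
  then have "dist u \<noteq> dist w" by metis
  moreover have "dist w \<le> Suc (dist u)" using e by (rule dist_edge_le)
  moreover have "dist u \<le> Suc (dist w)" using e by (simp add: dist_edge_le insert_commute)
  ultimately show ?thesis by linarith
qed

section \<open>Normalised rankings: bounds and parity\<close>

definition normalised_rankings :: "('a \<Rightarrow> int) set" where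
  "normalised_rankings = {h \<in> ranking_functions V E. h v = 0}"

lemma normalised_ext:
  "g \<in> normalised_rankings \<Longrightarrow> h \<in> normalised_rankings \<Longrightarrow> (\<And>u. u \<in> V \<Longrightarrow> g u = h u) \<Longrightarrow> g = h"
  unfolding normalised_rankings_def ranking_functions_def by (blast intro: PiE_ext)

lemma normalised_edge:
  "h \<in> normalised_rankings \<Longrightarrow> {u, w} \<in> E \<Longrightarrow> \<bar>h u - h w\<bar> = 1"
  unfolding normalised_rankings_def ranking_functions_def by blast

text \<open>Along a walk the value starts at \<open>h v = 0\<close> and changes by exactly one at
  each step.\<close>

lemma normalised_walk:
  assumes h: "h \<in> normalised_rankings" and "(v, u) \<in> adj ^^ k"
  shows "\<bar>h u\<bar> \<le> int k \<and> even (h u + int k)"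
  using assms(2)
proof (induction k arbitrary: u)
  case 0
  then have "u = v" by simp
  moreover have "h v = 0" using h by (simp add: normalised_rankings_def)
  ultimately show ?case by simp
next
  case (Suc k)
  then obtain y where y: "(v, y) \<in> adj ^^ k" "{y, u} \<in> E" by (auto simp: adj_def)
  have IH: "\<bar>h y\<bar> \<le> int k" "even (h y + int k)" using Suc.IH[OF y(1)] by auto
  have "h u = h y + 1 \<or> h u = h y - 1" using normalised_edge[OF h y(2)] by linarith
  then show ?case using IH by auto
qed

lemma normalised_bound:
  "h \<in> normalised_rankings \<Longrightarrow> u \<in> V \<Longrightarrow> \<bar>h u\<bar> \<le> int (dist u)"
  using normalised_walk dist_walk by blast

lemma normalised_parity:
  "h \<in> normalised_rankings \<Longrightarrow> u \<in> V \<Longrightarrow> even (h u + int (dist u))"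
  using normalised_walk dist_walk by blast

section \<open>The greatest normalised ranking and negation\<close>

text \<open>Greatest by \<open>normalised_bound\<close>; its negative is the least. The lambda is
  restricted to \<open>V\<close>, here and in \<open>negate\<close>, because ranking functions are
  extensional.\<close>

definition top_ranking :: "'a \<Rightarrow> int" where
  "top_ranking = (\<lambda>u\<in>V. int (dist u))"

definition negate :: "('a \<Rightarrow> int) \<Rightarrow> 'a \<Rightarrow> int" where
  "negate h = (\<lambda>u\<in>V. - h u)"

lemma top_normalised: "top_ranking \<in> normalised_rankings"
  unfolding normalised_rankings_def ranking_functions_def top_ranking_def
  using dist_edge edge_verts basepoint dist_basepoint by auto

lemma negate_normalised:
  assumes "h \<in> normalised_rankings" shows "negate h \<in> normalised_rankings"
proof -
  have "\<bar>negate h u - negate h w\<bar> = 1" if "{u, w} \<in> E" for u w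
    using normalised_edge[OF assms that] edge_verts[OF that] by (simp add: negate_def)
  then show ?thesis using assms basepoint
    unfolding normalised_rankings_def ranking_functions_def by (auto simp: negate_def)
qed

lemma negate_negate: "h \<in> normalised_rankings \<Longrightarrow> negate (negate h) = h"
  by (rule normalised_ext) (simp_all add: negate_normalised, simp add: negate_def)

section \<open>Raising vertices other than the basepoint\<close>

text \<open>The neighbours of a source lie exactly one above it, hence exactly one below after the
  raise. The condition \<open>w \<noteq> v\<close> preserves the value 0 at
  \<open>v\<close>.\<close>

lemma raise_normalised:
  assumes h: "h \<in> normalised_rankings" and w: "is_source V E h w" "w \<noteq> v"
  shows "vertex_raise w h \<in> normalised_rankings"
proof -
  have "\<bar>vertex_raise w h x - vertex_raise w h y\<bar> = 1" if e: "{x, y} \<in> E" for x y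
  proof -
    have "x \<noteq> y" using edge_verts[OF e] by blast
    moreover have "\<bar>h x - h y\<bar> = 1" using normalised_edge[OF h e] .
    moreover have "y = w \<Longrightarrow> h y < h x" "x = w \<Longrightarrow> h x < h y"
      using w(1) e unfolding is_source_def by (auto simp: insert_commute)
    ultimately show ?thesis unfolding vertex_raise_def by (auto split: if_splits)
  qed
  moreover have "vertex_raise w h \<in> V \<rightarrow>\<^sub>E UNIV"
    using h w(1) unfolding normalised_rankings_def ranking_functions_def vertex_raise_def is_source_def
    by (auto simp: PiE_iff extensional_def)
  moreover have "vertex_raise w h v = 0"
    using h w(2) by (simp add: normalised_rankings_def vertex_raise_def)
  ultimately show ?thesis
    unfolding normalised_rankings_def ranking_functions_def by blast
qed

lemma raise_towards:
  assumes g: "g \<in> normalised_rankings" and h: "h \<in> normalised_rankings"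
    and le: "\<forall>u\<in>V. g u \<le> h u" and neq: "g \<noteq> h"
  obtains w where "w \<in> V" "w \<noteq> v" "is_source V E g w"
    "\<forall>u\<in>V. vertex_raise w g u \<le> h u"
proof -
  define D where "D = {u \<in> V. g u < h u}"
  have "D \<noteq> {}"
    using normalised_ext[OF g h] le neq unfolding D_def by force
  moreover have "finite D" using finite_V by (simp add: D_def)
  ultimately obtain w where w: "w \<in> D" and least: "\<And>u. u \<in> D \<Longrightarrow> g w \<le> g u"
    using ex_min_if_finite[of "g ` D"] by (metis (no_types, lifting) finite_imageI image_iff image_is_empty linorder_not_less)
  have wV: "w \<in> V" and lt: "g w < h w" using w by (auto simp: D_def)
  have "g v = h v" using g h by (simp add: normalised_rankings_def)
  then have "w \<noteq> v" using lt by auto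
  moreover have "g w < g u" if e: "{u, w} \<in> E" for u
  proof (rule ccontr)
    assume "\<not> g w < g u"
    then have gu: "g u = g w - 1" using normalised_edge[OF g e] by linarith
    then have "u \<notin> D" using least by force
    \<comment> \<open>A lower neighbour escapes \<open>D\<close> by minimality, so \<open>g\<close>
      and \<open>h\<close> agree there; then \<open>h w \<le> h u + 1 = g w\<close>, against
      \<open>g w < h w\<close>.\<close>
    then have "g u = h u" using le edge_verts[OF e] by (force simp: D_def)
    then show False using normalised_edge[OF h e] gu lt by linarith
  qed
  then have "is_source V E g w" using wV by (simp add: is_source_def)
  \<comment> \<open>Equal parity turns the strict inequality into a gap of at least 2, leaving room
    for the raise.\<close>
  moreover have "g w + 2 \<le> h w"
  proof -
    have "even (g w + int (dist w))" "even (h w + int (dist w))"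
      using normalised_parity g h wV by auto
    then show ?thesis using lt by presburger
  qed
  then have "\<forall>u\<in>V. vertex_raise w g u \<le> h u" using le by (simp add: vertex_raise_def)
  ultimately show ?thesis using that wV by blast
qed

text \<open>Off \<open>w\<close> the two bounds coincide, and at \<open>w\<close> parity excludes
  the value halfway between them. This is what makes a raising a cover.\<close>

lemma raise_minimal:
  assumes g: "g \<in> normalised_rankings" and z: "z \<in> normalised_rankings"
    and w: "is_source V E g w" "w \<noteq> v"
    and le: "\<forall>u\<in>V. g u \<le> z u" "\<forall>u\<in>V. z u \<le> vertex_raise w g u"
  shows "z = g \<or> z = vertex_raise w g"
proof -
  have wV: "w \<in> V" using w(1) by (simp add: is_source_def)
  have off: "z u = g u" if "u \<in> V" "u \<noteq> w" for u
    using le that by (force simp: vertex_raise_def)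
  have "even (g w + int (dist w))" "even (z w + int (dist w))"
    using normalised_parity g z wV by auto
  moreover have "g w \<le> z w" "z w \<le> g w + 2"
    using le wV by (auto simp: vertex_raise_def)
  ultimately have "z w = g w \<or> z w = g w + 2" by presburger
  then show ?thesis
  proof
    assume "z w = g w"
    then have "z = g" using off by (intro normalised_ext[OF z g]) metis
    then show ?thesis ..
  next
    assume "z w = g w + 2"
    then have "z = vertex_raise w g"
      using off by (intro normalised_ext[OF z raise_normalised[OF g w]]) (simp add: vertex_raise_def)
    then show ?thesis ..
  qed
qed

section \<open>The height of a normalised ranking\<close>

text \<open>By \<open>normalised_parity\<close> the divisions by 2 are exact.\<close>

definition height :: "('a \<Rightarrow> int) \<Rightarrow> int" where
  "height h = (\<Sum>u\<in>V. (h u + int (dist u)) div 2)"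

lemma height_raise:
  assumes "w \<in> V" shows "height (vertex_raise w h) = height h + 1"
proof -
  have "height (vertex_raise w h)
      = (\<Sum>u\<in>V. (h u + int (dist u)) div 2 + (if u = w then 1 else 0))"
    unfolding height_def vertex_raise_def by (rule sum.cong) auto
  then show ?thesis using assms finite_V by (simp add: sum.distrib height_def)
qed

lemma height_nonneg: "h \<in> normalised_rankings \<Longrightarrow> 0 \<le> height h"
  unfolding height_def using normalised_bound by (force intro!: sum_nonneg)

text \<open>With \<open>d = dist u\<close>, the identity
  \<open>(d - h u) / 2 = d - (h u + d) / 2\<close> holds in each summand, and \<open>d\<close> is
  the summand of \<open>top_ranking\<close>. Parity makes it valid for \<open>div\<close>.\<close>

lemma height_negate:
  assumes "h \<in> normalised_rankings" shows "height (negate h) = height top_ranking - height h"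
proof -
  have "(negate h u + int (dist u)) div 2
      = (top_ranking u + int (dist u)) div 2 - (h u + int (dist u)) div 2" if "u \<in> V" for u
    using normalised_parity[OF assms that] that unfolding negate_def top_ranking_def
    by simp presburger
  then show ?thesis by (simp add: height_def sum_subtractf)
qed

lemma height_le: "h \<in> normalised_rankings \<Longrightarrow> height h \<le> height top_ranking"
  using height_nonneg[OF negate_normalised] height_negate by fastforce

text \<open>Any other ranking can be raised towards \<open>top_ranking\<close>, so its height is not
  maximal.\<close>

lemma height_eq_top:
  assumes h: "h \<in> normalised_rankings" and "height h = height top_ranking"
  shows "h = top_ranking"
proof (rule ccontr)
  assume "h \<noteq> top_ranking"
  moreover have "\<forall>u\<in>V. h u \<le> top_ranking u"
    using normalised_bound[OF h] by (force simp: top_ranking_def)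
  ultimately obtain w where w: "w \<in> V" "w \<noteq> v" "is_source V E h w"
    using raise_towards[OF h top_normalised] by metis
  then have "height h + 1 \<le> height top_ranking"
    using height_raise height_le[OF raise_normalised[OF h]] by metis
  then show False using assms(2) by simp
qed

section \<open>Shift classes and their normalised representatives\<close>

definition ranking_class :: "('a \<Rightarrow> int) \<Rightarrow> ('a \<Rightarrow> int) set" where
  "ranking_class h = shift_equiv V E `` {h}"

lemma mem_ranking_class: "h \<in> normalised_rankings \<Longrightarrow> h \<in> ranking_class h"
  by (auto simp: ranking_class_def shift_equiv_def normalised_rankings_def intro: exI[of _ 0])

text \<open>Normalised functions that differ by a constant agree, as the constant is seen at
  \<open>v\<close>; subtracting the value at \<open>v\<close> normalises any representative.\<close>

lemma bij_ranking_class: "bij_betw ranking_class normalised_rankings (rankings V E)"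
proof (rule bij_betwI')
  fix g h assume g: "g \<in> normalised_rankings" and h: "h \<in> normalised_rankings"
  show "ranking_class g = ranking_class h \<longleftrightarrow> g = h"
  proof
    assume "ranking_class g = ranking_class h"
    then have "h \<in> ranking_class g" using mem_ranking_class[OF h] by simp
    then obtain c where c: "\<forall>u\<in>V. h u = g u + c"
      by (auto simp: ranking_class_def shift_equiv_def)
    then have "c = 0" using g h basepoint by (simp add: normalised_rankings_def)
    then show "g = h" using c by (intro normalised_ext[OF g h]) simp
  qed simp
next
  fix h assume "h \<in> normalised_rankings"
  then show "ranking_class h \<in> rankings V E"
    by (auto simp: ranking_class_def rankings_def normalised_rankings_def intro: quotientI)
next
  fix B assume "B \<in> rankings V E"
  then obtain g where g: "g \<in> ranking_functions V E" and B: "B = shift_equiv V E `` {g}"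
    by (auto simp: rankings_def elim: quotientE)
  define h where "h = (\<lambda>u\<in>V. g u - g v)"
  have "\<bar>h x - h y\<bar> = 1" if e: "{x, y} \<in> E" for x y
    using g e edge_verts[OF e] by (auto simp: h_def ranking_functions_def)
  then have hr: "h \<in> ranking_functions V E"
    by (auto simp: ranking_functions_def h_def)
  then have "h \<in> normalised_rankings" using basepoint by (simp add: normalised_rankings_def h_def)
  \<comment> \<open>The classes of \<open>g\<close> and \<open>h\<close> are compared member by
    member, the shift constants differing by \<open>g v\<close>.\<close>
  moreover have "(\<exists>c. \<forall>u\<in>V. k u = g u + c) \<longleftrightarrow> (\<exists>c. \<forall>u\<in>V. k u = h u + c)" for k
  proof
    assume "\<exists>c. \<forall>u\<in>V. k u = g u + c"
    then obtain c where "\<forall>u\<in>V. k u = g u + c" ..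
    then show "\<exists>c. \<forall>u\<in>V. k u = h u + c" by (intro exI[of _ "c + g v"]) (simp add: h_def)
  next
    assume "\<exists>c. \<forall>u\<in>V. k u = h u + c"
    then obtain c where "\<forall>u\<in>V. k u = h u + c" ..
    then show "\<exists>c. \<forall>u\<in>V. k u = g u + c" by (intro exI[of _ "c - g v"]) (simp add: h_def)
  qed
  then have "B = ranking_class h"
    using g hr by (auto simp: B ranking_class_def shift_equiv_def)
  ultimately show "\<exists>h\<in>normalised_rankings. B = ranking_class h" by blast
qed

definition representative :: "('a \<Rightarrow> int) set \<Rightarrow> 'a \<Rightarrow> int" where
  "representative = the_inv_into normalised_rankings ranking_class"

lemma representative_class: "h \<in> normalised_rankings \<Longrightarrow> representative (ranking_class h) = h"
  using bij_ranking_class unfolding representative_def bij_betw_def by (simp add: the_inv_into_f_f)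

lemma rankings_eq: "rankings V E = ranking_class ` normalised_rankings"
  using bij_ranking_class by (simp add: bij_betw_def)

lemma class_inject:
  "g \<in> normalised_rankings \<Longrightarrow> h \<in> normalised_rankings \<Longrightarrow> ranking_class g = ranking_class h \<longleftrightarrow> g = h"
  using bij_ranking_class by (auto simp: bij_betw_def inj_on_def)

section \<open>The partial order on shift classes\<close>

text \<open>Pointwise comparison is not invariant under shifts, so only the normalised
  representatives are compared. This is where the order depends on \<open>v\<close>.\<close>

definition ranking_poset :: "('a \<Rightarrow> int) set rel" where
  "ranking_poset = {(ranking_class g, ranking_class h) | g h.
     g \<in> normalised_rankings \<and> h \<in> normalised_rankings \<and> (\<forall>u\<in>V. g u \<le> h u)}"

lemma class_le_iff:
  "g \<in> normalised_rankings \<Longrightarrow> h \<in> normalised_rankings \<Longrightarrow>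
    (ranking_class g, ranking_class h) \<in> ranking_poset \<longleftrightarrow> (\<forall>u\<in>V. g u \<le> h u)"
  by (auto simp: ranking_poset_def class_inject)

lemma ranking_poset_subset: "ranking_poset \<subseteq> rankings V E \<times> rankings V E"
  by (auto simp: ranking_poset_def rankings_eq)

lemma Field_ranking_poset: "Field ranking_poset = rankings V E"
proof
  show "Field ranking_poset \<subseteq> rankings V E"
    using ranking_poset_subset by (auto simp: Field_def)
  show "rankings V E \<subseteq> Field ranking_poset"
  proof
    fix B assume "B \<in> rankings V E"
    then have "(B, B) \<in> ranking_poset" by (auto simp: rankings_eq class_le_iff)
    then show "B \<in> Field ranking_poset" by (rule FieldI1)
  qed
qed

lemma Partial_order_ranking_poset: "Partial_order ranking_poset"
proof -
  have "refl_on (rankings V E) ranking_poset"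
    by (auto simp: refl_on_def rankings_eq class_le_iff)
  moreover have "trans ranking_poset"
  proof (rule transI)
    fix x y z assume a: "(x, y) \<in> ranking_poset" "(y, z) \<in> ranking_poset"
    then obtain f g h where fgh: "f \<in> normalised_rankings" "g \<in> normalised_rankings" "h \<in> normalised_rankings"
      "x = ranking_class f" "y = ranking_class g" "z = ranking_class h"
      using ranking_poset_subset unfolding rankings_eq by blast
    show "(x, z) \<in> ranking_poset"
      using a fgh by (auto simp: class_le_iff intro: order_trans)
  qed
  moreover have "antisym ranking_poset"
  proof (rule antisymI)
    fix x y assume a: "(x, y) \<in> ranking_poset" "(y, x) \<in> ranking_poset"
    then obtain g h where gh: "g \<in> normalised_rankings" "h \<in> normalised_rankings"
      "x = ranking_class g" "y = ranking_class h"
      using ranking_poset_subset unfolding rankings_eq by blast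
    have "g = h" using a gh by (intro normalised_ext) (auto simp: class_le_iff intro: order_antisym)
    then show "x = y" using gh by simp
  qed
  ultimately show ?thesis
    using ranking_poset_subset
    by (simp add: partial_order_on_def preorder_on_def Field_ranking_poset)
qed

section \<open>Covers are exactly the raisings away from the basepoint\<close>

lemma raise_covers:
  assumes g: "g \<in> normalised_rankings" and w: "is_source V E g w" "w \<noteq> v"
  shows "covers ranking_poset (ranking_class (vertex_raise w g)) (ranking_class g)"
proof -
  let ?r = "vertex_raise w g"
  have r: "?r \<in> normalised_rankings" using raise_normalised[OF g w] .
  have "?r w \<noteq> g w" by (simp add: vertex_raise_def)
  then have "g \<noteq> ?r" by metis
  moreover have "\<forall>u\<in>V. g u \<le> ?r u" by (simp add: vertex_raise_def)
  moreover have "z = ranking_class g \<or> z = ranking_class ?r"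
    if z: "(ranking_class g, z) \<in> ranking_poset" "(z, ranking_class ?r) \<in> ranking_poset" for z
  proof -
    obtain k where k: "k \<in> normalised_rankings" "z = ranking_class k"
      using z(1) ranking_poset_subset unfolding rankings_eq by blast
    then show ?thesis
      using raise_minimal[OF g k(1) w] z g r by (auto simp: class_le_iff)
  qed
  ultimately show ?thesis
    unfolding covers_def using g r by (auto simp: class_le_iff class_inject)
qed

text \<open>By \<open>raise_towards\<close> some raising of the lower ranking lies weakly below the
  upper one; a cover leaves no room in between, so the two coincide.\<close>

lemma covers_raise:
  assumes "covers ranking_poset C B"
  obtains g w where "g \<in> normalised_rankings" "w \<in> V" "w \<noteq> v" "is_source V E g w"
    "B = ranking_class g" "C = ranking_class (vertex_raise w g)"
proof -
  have BC: "(B, C) \<in> ranking_poset" "B \<noteq> C" using assms by (auto simp: covers_def)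
  then obtain g h where gh: "g \<in> normalised_rankings" "h \<in> normalised_rankings"
    "B = ranking_class g" "C = ranking_class h" "\<forall>u\<in>V. g u \<le> h u"
    by (auto simp: ranking_poset_def)
  moreover have "g \<noteq> h" using gh BC(2) by auto
  ultimately obtain w where w: "w \<in> V" "w \<noteq> v" "is_source V E g w"
    "\<forall>u\<in>V. vertex_raise w g u \<le> h u"
    using raise_towards by metis
  have r: "vertex_raise w g \<in> normalised_rankings" using raise_normalised gh(1) w(2,3) by blast
  have "covers ranking_poset (ranking_class (vertex_raise w g)) B"
    using raise_covers gh(1,3) w(2,3) by blast
  moreover have "(ranking_class (vertex_raise w g), C) \<in> ranking_poset"
    using r gh(2,4) w(4) by (simp add: class_le_iff)
  ultimately have "C = ranking_class (vertex_raise w g)"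
    using assms unfolding covers_def by metis
  then show ?thesis using that gh w by blast
qed

section \<open>The rank function and its uniqueness\<close>

definition poset_rank :: "('a \<Rightarrow> int) set \<Rightarrow> int" where
  "poset_rank B = height (representative B)"

lemma poset_rank_class: "h \<in> normalised_rankings \<Longrightarrow> poset_rank (ranking_class h) = height h"
  by (simp add: poset_rank_def representative_class)

lemma is_rank_function_poset_rank: "is_rank_function ranking_poset poset_rank"
proof -
  have "poset_rank C = poset_rank B + 1" if "covers ranking_poset C B" for B C
    using that by (rule covers_raise) (simp add: poset_rank_class raise_normalised height_raise)
  moreover have "0 \<in> poset_rank ` Field ranking_poset"
  proof
    show "0 = poset_rank (ranking_class (negate top_ranking))"
      by (simp add: poset_rank_class negate_normalised top_normalised height_negate)
    show "ranking_class (negate top_ranking) \<in> Field ranking_poset"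
      by (simp add: Field_ranking_poset rankings_eq negate_normalised top_normalised)
  qed
  ultimately show ?thesis
    unfolding is_rank_function_def
    by (auto simp: Field_ranking_poset rankings_eq poset_rank_class height_nonneg)
qed

text \<open>Every element climbs to the top through covers, along each of which
  \<open>\<sigma>\<close> and \<open>height\<close> both grow by 1; hence they differ by a constant,
  read off at the top.\<close>

lemma rank_function_from_top:
  assumes \<sigma>: "is_rank_function ranking_poset \<sigma>" and "h \<in> normalised_rankings"
  shows "\<sigma> (ranking_class h) = height h + (\<sigma> (ranking_class top_ranking) - height top_ranking)"
  using assms(2)
\<comment> \<open>The measure is the number of raisings still needed; by \<open>height_le\<close>
  the truncation by \<open>nat\<close> loses nothing.\<close>
proof (induction "nat (height top_ranking - height h)" arbitrary: h rule: less_induct)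
  case less
  show ?case
  proof (cases "h = top_ranking")
    case False
    moreover have "\<forall>u\<in>V. h u \<le> top_ranking u"
      using normalised_bound[OF less.prems] by (force simp: top_ranking_def)
    ultimately obtain w where w: "w \<in> V" "w \<noteq> v" "is_source V E h w"
      using raise_towards[OF less.prems top_normalised] by metis
    let ?r = "vertex_raise w h"
    have r: "?r \<in> normalised_rankings" using raise_normalised less.prems w by blast
    have hr: "height ?r = height h + 1" using w(1) by (rule height_raise)
    have "nat (height top_ranking - height ?r) < nat (height top_ranking - height h)"
      using hr height_le[OF r] by simp
    then have "\<sigma> (ranking_class ?r) = height ?r + (\<sigma> (ranking_class top_ranking) - height top_ranking)"
      using less.hyps r by blast
    moreover have "\<sigma> (ranking_class ?r) = \<sigma> (ranking_class h) + 1"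
      using \<sigma> raise_covers less.prems w unfolding is_rank_function_def by blast
    ultimately show ?thesis using hr by simp
  qed simp
qed

lemma ranked_poset_ranking_poset: "ranked_poset ranking_poset poset_rank"
proof -
  have "\<sigma> x = poset_rank x"
    if \<sigma>: "is_rank_function ranking_poset \<sigma>" and x: "x \<in> Field ranking_poset" for \<sigma> x
  proof -
    define c where "c = \<sigma> (ranking_class top_ranking) - height top_ranking"
    have eq: "\<sigma> y = poset_rank y + c" if "y \<in> Field ranking_poset" for y
      using that rank_function_from_top[OF \<sigma>]
      by (auto simp: Field_ranking_poset rankings_eq poset_rank_class c_def)
    \<comment> \<open>Both functions have least value 0: the zero \<open>y\<close> of
      \<open>\<sigma>\<close> gives \<open>c \<le> 0\<close>, and the zero \<open>z\<close> of
      \<open>poset_rank\<close> gives \<open>c \<ge> 0\<close>.\<close>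
    obtain y z where "y \<in> Field ranking_poset" "\<sigma> y = 0" "z \<in> Field ranking_poset" "poset_rank z = 0"
      using \<sigma> is_rank_function_poset_rank unfolding is_rank_function_def by (metis imageE)
    moreover from this have "0 \<le> poset_rank y" "0 \<le> \<sigma> z"
      using \<sigma> is_rank_function_poset_rank unfolding is_rank_function_def by blast+
    ultimately have "c = 0" using eq[of y] eq[of z] by linarith
    then show ?thesis using eq[OF x] by simp
  qed
  then show ?thesis
    unfolding ranked_poset_def
    using Partial_order_ranking_poset is_rank_function_poset_rank by blast
qed

section \<open>Height of the poset, sizes of its levels, and flips\<close>

lemma has_height_ranking_poset: "has_height ranking_poset poset_rank (height top_ranking)"
  unfolding has_height_def
  by (auto simp: Field_ranking_poset rankings_eq poset_rank_class height_le top_normalised image_image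
      intro!: image_eqI[of _ _ top_ranking])

lemma rank_level_eq:
  "rank_level ranking_poset poset_rank i = ranking_class ` {h \<in> normalised_rankings. height h = i}"
  by (auto simp: rank_level_def Field_ranking_poset rankings_eq poset_rank_class)

lemma card_rank_level:
  "card (rank_level ranking_poset poset_rank i) = card {h \<in> normalised_rankings. height h = i}"
  unfolding rank_level_eq
  by (rule card_image) (auto simp: inj_on_def class_inject)

text \<open>Negation is an involution exchanging the two levels by \<open>height_negate\<close>. For
  \<open>i\<close> out of range both levels are empty.\<close>

lemma card_rank_level_symmetric:
  "card (rank_level ranking_poset poset_rank i)
    = card (rank_level ranking_poset poset_rank (height top_ranking - i))"
proof -
  have "bij_betw negate {h \<in> normalised_rankings. height h = i}
      {h \<in> normalised_rankings. height h = height top_ranking - i}"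
    by (rule bij_betw_byWitness[where f' = negate])
      (auto simp: negate_negate negate_normalised height_negate)
  then show ?thesis unfolding card_rank_level by (rule bij_betw_same_card)
qed

lemma card_rank_level_top: "card (rank_level ranking_poset poset_rank (height top_ranking)) = 1"
proof -
  have "{h \<in> normalised_rankings. height h = height top_ranking} = {top_ranking}"
    using height_eq_top top_normalised by blast
  then show ?thesis by (simp add: card_rank_level)
qed

text \<open>The normalised representative witnesses the flip, which is always a raising: the raised
  function is again normalised and so lies in its own class.\<close>

lemma covers_flip:
  assumes "covers ranking_poset C B"
  shows "\<exists>w\<in>V. w \<noteq> v \<and> flip_at V E w B C"
  using assms
proof (rule covers_raise)
  fix g w assume "g \<in> normalised_rankings" "w \<in> V" "w \<noteq> v" "is_source V E g w"
    "B = ranking_class g" "C = ranking_class (vertex_raise w g)"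
  then show ?thesis
    unfolding flip_at_def raising_at_def using mem_ranking_class raise_normalised by blast
qed

end

theorem mainTheorem5:
  fixes n :: nat and V :: "'a set" and E :: "'a set set" and col :: "'a set \<Rightarrow> nat" and v :: 'a
  assumes "chromotopology n V E col"
    and "v \<in> V"
  shows "\<exists>(P :: ('a \<Rightarrow> int) set rel) \<rho> m.
      Field P = rankings V E
    \<and> ranked_poset P \<rho>
    \<and> has_height P \<rho> m
    \<and> (\<forall>i. card (rank_level P \<rho> i) = card (rank_level P \<rho> (m - i)))
    \<and> card (rank_level P \<rho> m) = 1
    \<and> card (rank_level P \<rho> 0) = 1
    \<and> (\<forall>B C. covers P C B \<longrightarrow> (\<exists>w\<in>V. w \<noteq> v \<and> flip_at V E w B C))"
proof -
  interpret chromotopology n V E col by fact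
  interpret pointed_bipartite_graph V E v
    by unfold_locales (fact simple connected bipartite \<open>v \<in> V\<close>)+
  \<comment> \<open>Rank symmetry carries uniqueness of the top element over to the bottom.\<close>
  have "card (rank_level ranking_poset poset_rank 0) = 1"
    using card_rank_level_symmetric[of 0] card_rank_level_top by simp
  then show ?thesis
    using Field_ranking_poset ranked_poset_ranking_poset has_height_ranking_poset
      card_rank_level_symmetric card_rank_level_top covers_flip by blast
qed

end
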